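(* Let $R=\{r_1,\ldots,r_l\}$ and $S=\{s_1,\ldots,s_m\}$ be disjoint sets of positive integers (with $r_1,\ldots,r_l$ distinct and $s_1,\ldots,s_m$ distinct), and let $I$ be a finite subset of $\mathbb{Z}^+\setminus(R\cup S)$. Suppose the greatest common divisor of $r_1,\ldots,r_l,s_1,\ldots,s_m$ is $1$. Then \[ \lim_{n\to\infty}\frac{p_{R>S,I}(n)}{p_{RSI}(n)}=\prod_{j=1}^l r_j\prod_{i=1}^m s_i\cdot\sum_{i=1}^l\frac{(-1)^{i-1}}{r_i\prod_{j=i+1}^l(r_j-r_i)\prod_{t=1}^{i-1}(r_i-r_t)\prod_{k=1}^m(s_k+r_i)}. \]
   Context: For pairwise disjoint sets $R,S,I\subseteq\mathbb{Z}^+$, $p_{RSI}(n)$ denotes the number of partitions of $n$ all of whose parts lie in $R\cup S\cup I$, and $p_{R>S,I}(n)$ denotes the number of those partitions in which the number of parts lying in $R$ (counted with multiplicity) is strictly greater than the number of parts lying in $S$ (counted with multiplicity). *)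

theory Defs
  imports Complex_Main "HOL-Library.Multiset"
begin

definition partitions_in :: "nat set \<Rightarrow> nat \<Rightarrow> nat multiset set" where
  "partitions_in A n = {P. 0 \<notin># P \<and> set_mset P \<subseteq> A \<and> sum_mset P = n}"

definition p_RSI :: "nat set \<Rightarrow> nat set \<Rightarrow> nat set \<Rightarrow> nat \<Rightarrow> nat" where
  "p_RSI R S I n = card (partitions_in (R \<union> S \<union> I) n)"

definition p_R_gt_S_I :: "nat set \<Rightarrow> nat set \<Rightarrow> nat set \<Rightarrow> nat \<Rightarrow> nat" where
  "p_R_gt_S_I R S I n =
     card {P \<in> partitions_in (R \<union> S \<union> I) n.
             size {#x \<in># P. x \<in> R#} > size {#x \<in># P. x \<in> S#}}"

end

theory Submission
  imports Defs "HOL-Computational_Algebra.Formal_Power_Series" "HOL-Real_Asymp.Real_Asymp"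
begin

text \<open>
  Let \<open>C\<^sub>d(R, S)\<close> be the generating function of the partitions whose number of parts in \<open>R\<close>
  exceeds the number of parts in \<open>S\<close> by more than \<open>d\<close>. Removing one copy of a part \<open>x\<close> or \<open>y\<close>
  from \<open>R\<close> gives \<open>(X\<^sup>x - X\<^sup>y) C\<^sub>d(R, S) = C\<^sub>d\<^sub>+\<^sub>1(R - {y}, S) - C\<^sub>d\<^sub>+\<^sub>1(R - {x}, S)\<close>, and by induction
  \<open>C\<^sub>d(R, S)\<close> is a sum over \<open>x \<in> R\<close> of the products of
  \<open>X\<^sup>x\<^sup>(\<^sup>d\<^sup>+\<^sup>1\<^sup>) / (1 - X\<^sup>x)\<close>, of \<open>X\<^sup>x / (X\<^sup>x - X\<^sup>y)\<close> for \<open>y \<in> R - {x}\<close>,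
  and of \<open>1 / (1 - X\<^sup>x\<^sup>+\<^sup>s)\<close> for \<open>s \<in> S\<close>. Up to sign and shift each summand is a product \<open>F\<close> of
  \<open>N = |R| + |S| + |I|\<close> factors \<open>1 / (1 - X\<^sup>a)\<close> whose exponents \<open>a\<close> again have gcd 1.

  The coefficients of such an \<open>F\<close> are asymptotic to \<open>n\<^sup>N\<^sup>-\<^sup>1 / ((N - 1)! \<Prod>a)\<close>: since \<open>(1 - X\<^sup>a) F\<close>
  has one factor fewer, they change by \<open>o(n\<^sup>N\<^sup>-\<^sup>1)\<close> under a shift by any \<open>a\<close>, hence under a shift
  by 1; and multiplying \<open>F\<close> by all \<open>1 + X + \<dots> + X\<^sup>a\<^sup>-\<^sup>1\<close> sums \<open>\<Prod>a\<close> shifted copies of \<open>F\<close> to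
  \<open>1 / (1 - X)\<^sup>N\<close>.
\<close>

section \<open>Coefficient asymptotics\<close>

unbundle fps_syntax

text \<open>With \<open>L = 0\<close> this says that the coefficients are o(n^k), so one predicate
  serves for main terms and for error terms.\<close>

definition lead :: "nat \<Rightarrow> real fps \<Rightarrow> real \<Rightarrow> bool" where
  "lead k F L \<longleftrightarrow> (\<lambda>n. F $ n / real n ^ k) \<longlonglongrightarrow> L"

lemma lead_zero: "lead k 0 0"
  by (simp add: lead_def)

lemma lead_add: "lead k F L \<Longrightarrow> lead k G M \<Longrightarrow> lead k (F + G) (L + M)"
  unfolding lead_def by (drule (1) tendsto_add) (simp add: add_divide_distrib)

lemma lead_diff: "lead k F L \<Longrightarrow> lead k G M \<Longrightarrow> lead k (F - G) (L - M)"
  unfolding lead_def by (drule (1) tendsto_diff) (simp add: diff_divide_distrib)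

lemma lead_sum: "(\<And>i. i \<in> A \<Longrightarrow> lead k (F i) (L i)) \<Longrightarrow> lead k (\<Sum>i\<in>A. F i) (\<Sum>i\<in>A. L i)"
  by (induction A rule: infinite_finite_induct) (auto intro: lead_add lead_zero)

lemma lead_const_mult: "lead k F L \<Longrightarrow> lead k (fps_const c * F) (c * L)"
  unfolding lead_def by (drule tendsto_mult_left[of _ _ _ c]) simp

text \<open>Both n / (n + a) and its inverse tend to 1, so their k-th powers do not affect the
  limit.\<close>

lemma lead_shift: "lead k (fps_X ^ a * F) L \<longleftrightarrow> lead k F L"
proof -
  have "(\<lambda>n. real n / real (n + a)) \<longlonglongrightarrow> 1" "(\<lambda>n. real (n + a) / real n) \<longlonglongrightarrow> 1"
    by real_asymp+
  from this[THEN tendsto_power, of k]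
  have ratio: "(\<lambda>n. (real n / real (n + a)) ^ k) \<longlonglongrightarrow> 1"
    "(\<lambda>n. (real (n + a) / real n) ^ k) \<longlonglongrightarrow> 1" by simp_all
  have offset: "(g \<longlonglongrightarrow> L) \<longleftrightarrow> (\<lambda>n. g (n + a)) \<longlonglongrightarrow> L" for g :: "nat \<Rightarrow> real"
    by (blast intro: LIMSEQ_offset LIMSEQ_ignore_initial_segment)
  have "lead k (fps_X ^ a * F) L \<longleftrightarrow> (\<lambda>n. (fps_X ^ a * F) $ (n + a) / real (n + a) ^ k) \<longlonglongrightarrow> L"
    unfolding lead_def by (rule offset)
  also have "\<dots> \<longleftrightarrow> (\<lambda>n. F $ n / real (n + a) ^ k) \<longlonglongrightarrow> L"
    by (simp add: fps_X_power_mult_nth)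
  also have "\<dots> \<longleftrightarrow> lead k F L" unfolding lead_def
  proof
    assume "(\<lambda>n. F $ n / real (n + a) ^ k) \<longlonglongrightarrow> L"
    from tendsto_mult[OF this ratio(2)]
    have "(\<lambda>n. F $ n / real (n + a) ^ k * (real (n + a) / real n) ^ k) \<longlonglongrightarrow> L" by simp
    then show "(\<lambda>n. F $ n / real n ^ k) \<longlonglongrightarrow> L"
      by (rule Lim_transform_eventually)
         (rule eventually_mono[OF eventually_gt_at_top[of 0]], simp add: power_divide)
  next
    assume "(\<lambda>n. F $ n / real n ^ k) \<longlonglongrightarrow> L"
    from tendsto_mult[OF this ratio(1)]
    have "(\<lambda>n. F $ n / real n ^ k * (real n / real (n + a)) ^ k) \<longlonglongrightarrow> L" by simp
    then show "(\<lambda>n. F $ n / real (n + a) ^ k) \<longlonglongrightarrow> L"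
      by (rule Lim_transform_eventually)
         (rule eventually_mono[OF eventually_gt_at_top[of 0]], simp add: power_divide)
  qed
  finally show ?thesis .
qed

text \<open>The series 1 / (1 - X^a) for \<open>a > 0\<close>; \<open>geo 0\<close> is 1, since 0
  divides only 0.\<close>

definition geo :: "nat \<Rightarrow> real fps" where
  "geo a = Abs_fps (\<lambda>n. if a dvd n then 1 else 0)"

lemma geo_mult: "a > 0 \<Longrightarrow> (1 - fps_X ^ a) * geo a = 1"
  by (rule fps_ext) (auto simp: algebra_simps fps_X_power_mult_nth geo_def dvd_diff_nat
      dest: dvd_diffD dvd_imp_le)

text \<open>Solves the recurrences that arise from adding one more copy of a part.\<close>

lemma geo_eqI: "a > 0 \<Longrightarrow> F = H + fps_X ^ a * F \<Longrightarrow> F = geo a * H"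
proof -
  assume a: "a > 0" and F: "F = H + fps_X ^ a * F"
  have "geo a * H = ((1 - fps_X ^ a) * geo a) * F"
    using arg_cong[OF F, of "\<lambda>x. geo a * x"] by (simp add: algebra_simps)
  then show ?thesis using geo_mult[OF a] by simp
qed

section \<open>Products of geometric series: bounds and the model case\<close>

abbreviation geos :: "nat multiset \<Rightarrow> real fps" where
  "geos M \<equiv> \<Prod>a\<in>#M. geo a"

text \<open>Multiplication by \<open>geo a\<close> sums some of the coefficients with index at most
  n, so every factor after the first costs at most a factor n + 1.\<close>

lemma geos_bound:
  assumes "M \<noteq> {#}"
  shows "\<bar>geos M $ n\<bar> \<le> real (n + 1) ^ (size M - 1)"
  using assms
proof (induction M arbitrary: n)
  case (add a M)
  show ?case
  proof (cases "M = {#}")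
    case False
    have "\<bar>geos (add_mset a M) $ n\<bar> \<le> (\<Sum>i=0..n. \<bar>geos M $ (n - i)\<bar>)"
      by (auto simp: fps_mult_nth geo_def intro!: order.trans[OF sum_abs] sum_mono)
    also have "\<dots> \<le> (\<Sum>i=0..n. real (n + 1) ^ (size M - 1))"
      using add.IH[OF False] by (intro sum_mono) (meson diff_le_self of_nat_mono
          add_le_mono1 order.trans power_mono of_nat_0_le_iff)
    also have "\<dots> = real (n + 1) ^ size M"
      using False by (cases "size M") auto
    finally show ?thesis by simp
  qed (simp add: geo_def)
qed simp

lemma lead_geos_zero: "lead (size M) (geos M) 0"
proof (cases "M = {#}")
  case True
  \<comment> \<open>The empty product is 1; here the exponent is 0, but the coefficients vanish from
    index 1 on.\<close>
  have "(\<lambda>n. (1 :: real fps) $ n) \<longlonglongrightarrow> 0"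
    by (rule tendsto_eventually) (auto intro!: eventually_sequentiallyI[of 1])
  then show ?thesis using True by (simp add: lead_def)
next
  case False
  then obtain k where k: "size M = Suc k" by (cases "size M") auto
  have "(\<lambda>n. (real (n + 1) / real n) ^ k * (1 / real n)) \<longlonglongrightarrow> 1 ^ k * 0"
    by (intro tendsto_mult tendsto_power) real_asymp+
  then have "(\<lambda>n. real (n + 1) ^ k / real n ^ Suc k) \<longlonglongrightarrow> 0"
    by (simp add: power_divide mult.commute)
  then show ?thesis unfolding lead_def k
    by (rule tendsto_0_le[where K = 1])
       (use geos_bound[OF False] k in \<open>auto intro!: always_eventually divide_right_mono\<close>)
qed

lemma lead_geo_one_power: "lead k (geo 1 ^ Suc k) (1 / fact k)"
proof -
  have geo1: "geo 1 = inverse (1 - fps_X)"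
    using fps_inverse_unique[OF geo_mult[of 1]] by simp
  have nth: "geo 1 ^ Suc k $ n = real (n + k choose k)" for n
    using one_minus_const_fps_X_neg_power'[of "Suc k" "1::real"] binomial_symmetric[of n "n + k"]
    unfolding geo1 by (simp add: add.commute flip: fps_inverse_power del: power_Suc)
  \<comment> \<open>Going from k to k + 1 multiplies the binomial by (n + k + 1) / (k + 1), and (n +
    k + 1) / n tends to 1.\<close>
  have "(\<lambda>n. real (n + k choose k) / real n ^ k) \<longlonglongrightarrow> 1 / fact k" for k
  proof (induction k)
    case (Suc k)
    have "(\<lambda>n. real (n + k choose k) / real n ^ k * ((real n + real k + 1) / real n / real (Suc k)))
      \<longlonglongrightarrow> 1 / fact k * (1 / real (Suc k))"
      by (intro tendsto_mult Suc.IH tendsto_divide[OF _ tendsto_const]) (real_asymp | simp)+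
    then have "(\<lambda>n. real (n + k choose k) * (real n + real k + 1) / real (Suc k) / real n ^ Suc k) \<longlonglongrightarrow> 1 / fact (Suc k)"
      by (simp add: mult_ac)
    moreover have "real (n + Suc k choose Suc k) = real (n + k choose k) * (real n + real k + 1) / real (Suc k)" for n
      using Suc_times_binomial[of k "n + k"] by (simp add: field_simps flip: of_nat_mult of_nat_Suc of_nat_add)
    ultimately show ?case by (simp only:)
  qed simp
  then show ?thesis unfolding lead_def nth .
qed

text \<open>The subtractive Euclidean algorithm. It is applied to the set of shifts that change the
  coefficients by o(n^k).\<close>

lemma Gcd_in_difference_closed:
  fixes T A :: "nat set"
  assumes "0 \<in> T" and diff: "\<And>a b. a \<in> T \<Longrightarrow> b \<in> T \<Longrightarrow> b \<le> a \<Longrightarrow> a - b \<in> T"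
    and "finite A" "A \<subseteq> T"
  shows "Gcd A \<in> T"
proof -
  have gcd: "gcd a b \<in> T" if "a \<in> T" "b \<in> T" for a b
    using that
  proof (induction "a + b" arbitrary: a b rule: less_induct)
    case less
    consider "a = 0" | "b = 0" | "0 < b" "b \<le> a" | "0 < a" "a < b" by linarith
    then show ?case
    proof cases
      case 3
      then have "gcd (a - b) b \<in> T" using less diff by simp
      then show ?thesis using 3 by (simp add: gcd_diff1_nat)
    next
      case 4
      then have "gcd (b - a) a \<in> T" using less diff by simp
      then show ?thesis using 4 by (metis gcd_diff1_nat gcd.commute less_imp_le)
    qed (use less in auto)
  qed
  show ?thesis using assms(3,4,1)
    by (induction A rule: finite_induct) (auto intro: gcd)
qed

section \<open>Averaging over shifts\<close>

lemma lead_average_zero: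
  assumes "lead k D 0"
  shows "lead k ((\<Sum>j<a. fps_X ^ j) * D) 0"
  using lead_sum[of "{..<a}" k "\<lambda>j. fps_X ^ j * D" "\<lambda>_. 0"] assms
  by (simp add: lead_shift sum_distrib_right)

text \<open>X^j F - F is a sum of j shifted copies of (X - 1) F, so its coefficients are o(n^k).
  Hence each factor 1 + X + ... + X^(a-1) acts on F like the number a.\<close>

lemma lead_average:
  assumes slow: "lead k ((1 - fps_X) * F) 0"
  shows "lead k ((\<Prod>a\<in>#M. \<Sum>j<a. fps_X ^ j) * F - fps_const (real (\<Prod>\<^sub># M)) * F) 0"
proof (induction M)
  case (add a M)
  define P where "P = (\<Prod>a\<in>#M. \<Sum>j<a. fps_X ^ j :: real fps)"
  define S :: "real fps" where "S = (\<Sum>j<a. fps_X ^ j)"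
  have "lead k ((fps_X ^ j - 1) * F) 0" for j
  proof -
    have "(fps_X ^ j - 1) * F = fps_const (-1) * ((\<Sum>i<j. fps_X ^ i) * ((1 - fps_X) * F))"
      by (subst power_diff_1_eq) (simp add: algebra_simps flip: fps_const_neg)
    then show ?thesis
      using lead_const_mult[OF lead_average_zero[OF slow, of j], of "-1"]
      by (simp only: mult_zero_right)
  qed
  then have "lead k (\<Sum>j<a. (fps_X ^ j - 1) * F) (\<Sum>j<a. 0)"
    by (intro lead_sum)
  also have "(\<Sum>j<a. (fps_X ^ j - 1) * F) = S * F - of_nat a * F"
    by (simp add: S_def sum_subtractf left_diff_distrib sum_distrib_right)
  finally have *: "lead k (S * F - of_nat a * F) 0" by simp
  \<comment> \<open>First \<open>P\<close> is replaced by the product of \<open>M\<close> under the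
    factor \<open>S\<close>, then \<open>S\<close> by \<open>a\<close>.\<close>
  have "(\<Prod>a\<in>#add_mset a M. \<Sum>j<a. fps_X ^ j) * F - fps_const (real (\<Prod>\<^sub># (add_mset a M))) * F
    = S * (P * F - fps_const (real (\<Prod>\<^sub># M)) * F)
      + fps_const (real (\<Prod>\<^sub># M)) * (S * F - of_nat a * F)"
    by (simp add: P_def S_def algebra_simps fps_of_nat flip: fps_const_mult)
  moreover have "lead k (S * (P * F - fps_const (real (\<Prod>\<^sub># M)) * F)) 0"
    unfolding S_def using add.IH by (intro lead_average_zero) (simp add: P_def)
  ultimately show ?case
    using lead_add lead_const_mult[OF *, of "real (\<Prod>\<^sub># M)"] by fastforce
qed (simp add: lead_zero)

text \<open>If all exponents shared a factor g > 1, the coefficients would vanish off the multiples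
  of g and no such limit could exist. The gcd condition excludes this by forcing slow variation
  under the shift by 1.\<close>

lemma lead_geos:
  assumes pos: "0 \<notin># M" and gcd: "Gcd (set_mset M) = 1" and size: "size M = Suc k"
  shows "lead k (geos M) (1 / (fact k * real (\<Prod>\<^sub># M)))"
proof -
  define T where "T = {a. lead k ((1 - fps_X ^ a) * geos M) 0}"
  have "a \<in> T" if a: "a \<in># M" for a
  proof -
    obtain M' where M': "M = add_mset a M'" using a by (metis insert_DiffM)
    have "(1 - fps_X ^ a) * geos M = ((1 - fps_X ^ a) * geo a) * geos M'"
      by (simp add: M' mult.assoc)
    also have "\<dots> = geos M'" using a pos by (subst geo_mult) (auto intro: gr0I)
    finally have "(1 - fps_X ^ a) * geos M = geos M'" .
    moreover have "lead k (geos M') 0" using lead_geos_zero[of M'] size M' by simp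
    ultimately show ?thesis by (simp only: T_def mem_Collect_eq)
  qed
  \<comment> \<open>Closure under subtraction rests on (1 - X^a) - (1 - X^b) = X^b (1 -
    X^(a-b)).\<close>
  moreover have "a - b \<in> T" if "a \<in> T" "b \<in> T" "b \<le> a" for a b
  proof -
    have "lead k ((1 - fps_X ^ a) * geos M - (1 - fps_X ^ b) * geos M) (0 - 0)"
      using that by (intro lead_diff) (auto simp: T_def)
    also have "(1 - fps_X ^ a) * geos M - (1 - fps_X ^ b) * geos M
      = fps_X ^ b * ((1 - fps_X ^ (a - b)) * geos M)"
      using power_add[of "fps_X :: real fps" b "a - b"] \<open>b \<le> a\<close> by (simp add: algebra_simps)
    finally show ?thesis by (simp add: lead_shift T_def)
  qed
  ultimately have "Gcd (set_mset M) \<in> T"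
    by (intro Gcd_in_difference_closed) (auto simp: T_def lead_zero)
  then have slow: "lead k ((1 - fps_X) * geos M) 0" by (simp add: gcd T_def)
  \<comment> \<open>Factor by factor, (1 + ... + X^(a-1)) / (1 - X^a) = 1 / (1 - X).\<close>
  have "(\<Prod>a\<in>#N. \<Sum>j<a. fps_X ^ j) * geos N = geo 1 ^ size N" if "0 \<notin># N" for N
    using that
  proof (induction N)
    case (add a N)
    have "(1 - fps_X) * (\<Sum>j<a. fps_X ^ j) * geo a = (1 - fps_X ^ 1) * geo 1"
      using add.prems geo_mult[of a] geo_mult[of 1] by (auto simp: one_diff_power_eq[symmetric])
    then have "(\<Sum>j<a. fps_X ^ j) * geo a = geo 1"
      by (metis (no_types, lifting) mult.assoc mult_cancel_left power_one_right geo_mult zero_less_one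
          mult_zero_left zero_neq_one)
    then show ?case using add by (simp add: ac_simps)
  qed simp
  with pos size have "(\<Prod>a\<in>#M. \<Sum>j<a. fps_X ^ j) * geos M = geo 1 ^ Suc k" by metis
  with lead_diff[OF lead_geo_one_power[of k] lead_average[OF slow, of M]]
  have "lead k (fps_const (real (\<Prod>\<^sub># M)) * geos M) (1 / fact k)" by simp
  from lead_const_mult[OF this, of "1 / real (\<Prod>\<^sub># M)"] pos show ?thesis
    by (simp add: mult.assoc[symmetric] prod_mset_zero_iff mult.commute)
qed

section \<open>Generating functions\<close>

text \<open>The weight is +1 on \<open>R\<close>, -1 on \<open>S\<close> and 0 on \<open>I\<close>
  for the comparison, and constantly 0 for plain counting. The threshold is an integer so that it
  can drop to -1, where the condition is void for nonnegative weights.\<close>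

definition excess :: "(nat \<Rightarrow> int) \<Rightarrow> nat set \<Rightarrow> int \<Rightarrow> real fps" where
  "excess w A d = Abs_fps (\<lambda>n. real (card {P \<in> partitions_in A n. d < (\<Sum>x\<in>#P. w x)}))"

lemma finite_partitions_in:
  assumes "finite A"
  shows "finite (partitions_in A n)"
proof -
  have "size P \<le> sum_mset P" if "0 \<notin># P" for P :: "nat multiset"
    using that by (induction P) auto
  then have "partitions_in A n \<subseteq> (\<Union>k\<le>n. multisets_of_size A k)"
    by (auto simp: partitions_in_def multisets_of_size_def)
  then show ?thesis by (rule finite_subset) (use assms in auto)
qed

text \<open>Partitions are split by whether \<open>y\<close> occurs; removing one copy lowers the
  sum by \<open>y\<close> and the total weight by \<open>w y\<close>.\<close>

lemma excess_insert:
  assumes "finite A" "y \<notin> A" "y > 0"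
  shows "excess w (insert y A) d = excess w A d + fps_X ^ y * excess w (insert y A) (d - w y)"
proof (rule fps_ext)
  fix n
  define T where "T A n d = {P \<in> partitions_in A n. d < (\<Sum>x\<in>#P. w x)}" for A n d
  have fin: "finite (T B n d)" if "finite B" for B n d
    using finite_partitions_in[OF that] by (simp add: T_def)
  \<comment> \<open>Truncated subtraction gives \<open>n - y = 0\<close> for \<open>n < y\<close>,
    which could admit a spurious \<open>{#y#}\<close>; hence the case distinction.\<close>
  define U where "U = (if n < y then {} else add_mset y ` T (insert y A) (n - y) (d - w y))"
  have "T (insert y A) n d = T A n d \<union> U"
  proof (intro equalityI subsetI)
    fix P assume P: "P \<in> T (insert y A) n d"
    show "P \<in> T A n d \<union> U"
    proof (cases "y \<in># P")
      case True
      then obtain Q where Q: "P = add_mset y Q" by (metis insert_DiffM)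
      then show ?thesis using P by (auto simp: T_def U_def partitions_in_def)
    qed (use P in \<open>auto simp: T_def partitions_in_def\<close>)
  qed (use assms in \<open>auto simp: T_def U_def partitions_in_def split: if_splits\<close>)
  moreover have "T A n d \<inter> U = {}"
  proof -
    have "y \<in># P" if "P \<in> U" for P using that by (auto simp: U_def split: if_splits)
    moreover have "y \<notin># P" if "P \<in> T A n d" for P
      using that assms(2) by (auto simp: T_def partitions_in_def)
    ultimately show ?thesis by blast
  qed
  moreover have "card U = (if n < y then 0 else card (T (insert y A) (n - y) (d - w y)))"
    by (simp add: U_def card_image inj_on_def)
  moreover have "finite U" using assms fin by (simp add: U_def)
  ultimately have "card (T (insert y A) n d)
    = card (T A n d) + (if n < y then 0 else card (T (insert y A) (n - y) (d - w y)))"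
    using assms fin by (simp add: card_Un_disjoint)
  then show "excess w (insert y A) d $ n
    = (excess w A d + fps_X ^ y * excess w (insert y A) (d - w y)) $ n"
    by (simp add: excess_def T_def fps_X_power_mult_nth)
qed

lemma excess_cong:
  assumes "\<And>P. set_mset P \<subseteq> A \<Longrightarrow> d < (\<Sum>x\<in>#P. w x) \<longleftrightarrow> d' < (\<Sum>x\<in>#P. w' x)"
  shows "excess w A d = excess w' A d'"
proof -
  have "{P \<in> partitions_in A n. d < (\<Sum>x\<in>#P. w x)} = {P \<in> partitions_in A n. d' < (\<Sum>x\<in>#P. w' x)}" for n
    by (intro Collect_cong conj_cong refl assms) (simp add: partitions_in_def)
  then show ?thesis by (simp add: excess_def)
qed

lemma excess_eq_0:
  assumes "\<And>x. x \<in> A \<Longrightarrow> w x \<le> 0" "0 \<le> d"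
  shows "excess w A d = 0"
proof -
  have "(\<Sum>x\<in>#P. w x) \<le> 0" if "set_mset P \<subseteq> A" for P
    using that assms(1) by (induction P) (auto intro: add_nonpos_nonpos)
  then have "{P \<in> partitions_in A n. d < (\<Sum>x\<in>#P. w x)} = {}" for n
    using assms(2) by (simp add: partitions_in_def) (meson leD order.trans)
  then show ?thesis by (intro fps_ext) (simp only: excess_def fps_nth_Abs_fps card.empty of_nat_0 fps_zero_nth)
qed

text \<open>The condition is void, so weight 0 and threshold -1 serve as well. With them the
  threshold is the same on both sides of \<open>excess_insert\<close>, and each part contributes one
  geometric series.\<close>

lemma excess_total:
  assumes "finite A" "A \<subseteq> {0<..}" "\<And>x. x \<in> A \<Longrightarrow> 0 \<le> w x" "d < 0"
  shows "excess w A d = (\<Prod>a\<in>A. geo a)"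
proof -
  have "(\<Sum>x\<in>#P. w x) \<ge> 0" if "set_mset P \<subseteq> A" for P
    using that assms(3) by (induction P) auto
  then have "excess w A d = excess (\<lambda>_. 0) A (-1)"
    using assms(4) by (intro excess_cong) (simp add: order.strict_trans2)
  also have "\<dots> = (\<Prod>a\<in>A. geo a)"
    using assms(1,2)
  proof (induction A rule: finite_induct)
    case empty
    have "{P \<in> partitions_in {} n. - 1 < (\<Sum>x\<in>#P. 0 :: int)} = (if n = 0 then {{#}} else {})" for n
      by (auto simp: partitions_in_def)
    then show ?case by (intro fps_ext) (simp add: excess_def)
  next
    case (insert y A)
    then have "excess (\<lambda>_. 0) (insert y A) (-1) = geo y * excess (\<lambda>_. 0) A (-1)"
      using excess_insert[of A y "\<lambda>_. 0" "-1"] by (intro geo_eqI) auto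
    with insert show ?case by simp
  qed
  finally show ?thesis .
qed

lemma excess_neutral:
  assumes "finite J" "finite A" "J \<inter> A = {}" "J \<subseteq> {0<..}" "\<And>x. x \<in> J \<Longrightarrow> w x = 0"
  shows "excess w (A \<union> J) d = (\<Prod>a\<in>J. geo a) * excess w A d"
  using assms
proof (induction J rule: finite_induct)
  case (insert y J)
  then have "excess w (insert y (A \<union> J)) d = geo y * excess w (A \<union> J) d"
    using excess_insert[of "A \<union> J" y w d] by (intro geo_eqI) auto
  with insert show ?case by (simp add: mult.assoc)
qed simp

text \<open>The base case |R| = 1 of the general formula.\<close>

lemma excess_single:
  assumes "finite S" "x \<notin> S" "x > 0" "S \<subseteq> {0<..}" "w x = 1" "\<And>y. y \<in> S \<Longrightarrow> w y = -1"
  shows "excess w (insert x S) (int d) = fps_X ^ (x * Suc d) * geo x * (\<Prod>y\<in>S. geo (x + y))"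
  using assms
proof (induction S arbitrary: d rule: finite_induct)
  case empty
  \<comment> \<open>Only the empty partition avoids \<open>x\<close>, and its weight 0 does not
    exceed the threshold. Removing \<open>d + 1\<close> copies of \<open>x\<close> brings the
    threshold to -1.\<close>
  have step: "excess w {x} (int d) = fps_X ^ x * excess w {x} (int d - 1)" for d
    using excess_insert[of "{}" x w "int d"] excess_eq_0[of "{}" w "int d"] empty by simp
  have "excess w {x} (int d) = fps_X ^ (x * Suc d) * excess w {x} (-1)"
    by (induction d) (use step[of 0] step[of "Suc _"] in \<open>simp_all add: power_add mult.assoc\<close>)
  also have "excess w {x} (-1) = geo x" using empty by (subst excess_total) auto
  finally show ?case by simp
next
  case (insert y S)
  let ?A = "insert x (insert y S)"
  \<comment> \<open>All other parts have weight -1, so \<open>x\<close> must occur. The recurrence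
    in \<open>y\<close> raises the threshold by one, which costs X^x by this identity; the result is
    a fixed-point equation with factor X^(x+y).\<close>
  have shift: "excess w ?A (int d + 1) = fps_X ^ x * excess w ?A (int d)"
    using excess_insert[of "insert y S" x w "int d + 1"] excess_eq_0[of "insert y S" w "int d + 1"]
      insert.prems insert.hyps by force
  have "excess w ?A (int d) = excess w (insert x S) (int d) + fps_X ^ y * excess w ?A (int d + 1)"
    using excess_insert[of "insert x S" y w "int d"] insert.prems insert.hyps
    by (auto simp: insert_commute)
  then have "excess w ?A (int d) = geo (x + y) * excess w (insert x S) (int d)"
    unfolding shift using insert.prems by (intro geo_eqI) (auto simp: power_add mult_ac)
  with insert show ?case by simp
qed

section \<open>Power series for X^a / (X^a - X^b) and the sum over R\<close>

text \<open>For \<open>a \<noteq> b\<close> this is the power series \<open>X\<^sup>a / (X\<^sup>a - X\<^sup>b)\<close>.\<close>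

definition kern :: "nat \<Rightarrow> nat \<Rightarrow> real fps" where
  "kern a b = (if a < b then geo (b - a) else - (fps_X ^ (a - b) * geo (a - b)))"

lemma kern_mult:
  assumes "a \<noteq> b"
  shows "kern a b * (fps_X ^ a - fps_X ^ b) = fps_X ^ a"
proof (cases "a < b")
  case True
  then have "fps_X ^ b = (fps_X :: real fps) ^ a * fps_X ^ (b - a)"
    by (metis power_add le_add_diff_inverse less_imp_le)
  then have "kern a b * (fps_X ^ a - fps_X ^ b) = fps_X ^ a * ((1 - fps_X ^ (b - a)) * geo (b - a))"
    using True by (simp add: kern_def algebra_simps)
  then show ?thesis using True by (simp add: geo_mult)
next
  case False
  then have eq: "fps_X ^ a = (fps_X :: real fps) ^ b * fps_X ^ (a - b)"
    by (metis power_add le_add_diff_inverse linorder_not_less)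
  then have "kern a b * (fps_X ^ a - fps_X ^ b)
    = fps_X ^ b * fps_X ^ (a - b) * ((1 - fps_X ^ (a - b)) * geo (a - b))"
    using False by (simp add: kern_def algebra_simps)
  then show ?thesis using False assms eq by (simp add: geo_mult)
qed

lemma fps_X_power_diff_neq_0: "a \<noteq> b \<Longrightarrow> fps_X ^ a - fps_X ^ b \<noteq> (0 :: real fps)"
proof
  assume "a \<noteq> b" and "fps_X ^ a - fps_X ^ b = (0 :: real fps)"
  then have "subdegree (fps_X ^ a :: real fps) = subdegree (fps_X ^ b :: real fps)" by simp
  with \<open>a \<noteq> b\<close> show False by (simp only: fps_X_power_subdegree)
qed

text \<open>Over the common denominator, \<open>kern i x - kern i y\<close> has numerator X^i (X^x -
  X^y). The denominators are multiplied out and then cancelled, as real power series have no zero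
  divisors.\<close>

lemma kern_partial_fraction:
  assumes "i \<noteq> x" "i \<noteq> y"
  shows "(fps_X ^ x - fps_X ^ y) * (kern i x * kern i y) = fps_X ^ i * (kern i x - kern i y)"
proof -
  let ?X = "\<lambda>a. fps_X ^ a :: real fps"
  have "(?X i - ?X x) * (?X i - ?X y) * ((?X x - ?X y) * (kern i x * kern i y))
    = (?X x - ?X y) * (kern i x * (?X i - ?X x)) * (kern i y * (?X i - ?X y))"
    by (simp only: ac_simps)
  also have "\<dots> = ?X i * ((kern i x * (?X i - ?X x)) * (?X i - ?X y) - (kern i y * (?X i - ?X y)) * (?X i - ?X x))"
    unfolding assms[THEN kern_mult] by (simp add: algebra_simps)
  also have "\<dots> = (?X i - ?X x) * (?X i - ?X y) * (?X i * (kern i x - kern i y))"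
    by (simp add: algebra_simps)
  finally show ?thesis using assms by (simp add: fps_X_power_diff_neq_0)
qed

lemma excess_sum:
  assumes "finite R" "R \<noteq> {}" "finite S" "R \<inter> S = {}" "R \<subseteq> {0<..}" "S \<subseteq> {0<..}"
    "\<And>x. x \<in> R \<Longrightarrow> w x = 1" "\<And>y. y \<in> S \<Longrightarrow> w y = -1"
  shows "excess w (R \<union> S) (int d) = (\<Sum>x\<in>R. fps_X ^ (x * Suc d) * geo x
    * (\<Prod>y\<in>R - {x}. kern x y) * (\<Prod>y\<in>S. geo (x + y)))"
  using assms
proof (induction "card R" arbitrary: R d rule: less_induct)
  case less
  show ?case
  proof (cases "card R = 1")
    case True
    then obtain x where "R = {x}" by (auto simp: card_1_singleton_iff)
    with less.prems show ?thesis using excess_single[of S x w d] by simp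
  next
    case False
    obtain x where x: "x \<in> R" using less.prems by blast
    have "R \<noteq> {x}" using False by auto
    then obtain y where y: "y \<in> R" "y \<noteq> x" using x by blast
    define Q where "Q = R - {x, y}"
    have R: "R = insert x (insert y Q)" and Q: "x \<notin> Q" "y \<notin> Q" "finite Q"
      using x y less.prems(1) by (auto simp: Q_def)
    \<comment> \<open>\<open>t i\<close> is the part of the summand that does not involve
      \<open>R\<close>, and \<open>u i\<close> collects the kernels over the common set
      \<open>Q\<close>; only kernels at \<open>x\<close> and \<open>y\<close> remain to be
      tracked.\<close>
    define t where "t i = fps_X ^ (i * Suc d) * geo i * (\<Prod>s\<in>S. geo (i + s))" for i
    define u where "u i = (\<Prod>j\<in>Q - {i}. kern i j)" for i
    let ?X = "\<lambda>a. fps_X ^ a :: real fps"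
    \<comment> \<open>The induction hypothesis for \<open>R\<close> without one of \<open>x\<close>,
      \<open>y\<close>. Raising the threshold from \<open>d\<close> to \<open>d + 1\<close> gives
      the extra factor X^i.\<close>
    have drop: "excess w (insert z Q \<union> S) (int (Suc d))
      = (\<Sum>i\<in>Q. ?X i * t i * u i * kern i z) + ?X z * t z * u z" if z: "z = x \<or> z = y" for z
    proof -
      have "excess w (insert z Q \<union> S) (int (Suc d)) = (\<Sum>i\<in>insert z Q. fps_X ^ (i * Suc (Suc d)) * geo i
        * (\<Prod>j\<in>insert z Q - {i}. kern i j) * (\<Prod>j\<in>S. geo (i + j)))"
        using z Q y less.prems by (intro less.hyps) (auto simp: R)
      also have "\<dots> = (\<Sum>i\<in>insert z Q. ?X i * t i * (\<Prod>j\<in>insert z Q - {i}. kern i j))"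
        by (simp add: t_def power_add mult_ac)
      also have "\<dots> = (\<Sum>i\<in>Q. ?X i * t i * (\<Prod>j\<in>insert z Q - {i}. kern i j))
        + ?X z * t z * (\<Prod>j\<in>insert z Q - {z}. kern z j)"
        using z Q by (subst sum.insert) (auto simp: add.commute)
      also have "(\<Prod>j\<in>insert z Q - {z}. kern z j) = u z" unfolding u_def
        using z Q by (intro prod.cong) auto
      also have "(\<Sum>i\<in>Q. ?X i * t i * (\<Prod>j\<in>insert z Q - {i}. kern i j)) = (\<Sum>i\<in>Q. ?X i * t i * u i * kern i z)"
      proof (rule sum.cong[OF refl])
        fix i assume i: "i \<in> Q"
        have "insert z Q - {i} = insert z (Q - {i})" "z \<notin> Q - {i}" using i z Q by auto
        then have "(\<Prod>j\<in>insert z Q - {i}. kern i j) = kern i z * u i"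
          using Q by (simp only: u_def prod.insert finite_Diff simp_thms)
        then show "?X i * t i * (\<Prod>j\<in>insert z Q - {i}. kern i j) = ?X i * t i * u i * kern i z"
          by (simp only: mult_ac)
      qed
      finally show ?thesis .
    qed
    have rec: "excess w (R \<union> S) (int (Suc d)) = excess w (R - {z} \<union> S) (int (Suc d)) + ?X z * excess w (R \<union> S) (int d)"
      if "z \<in> R" for z
    proof -
      have "R \<union> S = insert z (R - {z} \<union> S)" using that by auto
      then show ?thesis using excess_insert[of "R - {z} \<union> S" z w "int (Suc d)"] that less.prems by auto
    qed
    have "R - {x} = insert y Q" "R - {y} = insert x Q" using R Q y by auto
    \<comment> \<open>Subtracting the two recurrences eliminates the unknown series for
      \<open>R\<close> at threshold \<open>d + 1\<close>.\<close>
    with rec[OF x] rec[OF y(1)] have "(?X x - ?X y) * excess w (R \<union> S) (int d)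
      = excess w (insert x Q \<union> S) (int (Suc d)) - excess w (insert y Q \<union> S) (int (Suc d))"
      by (simp add: algebra_simps)
    also have "\<dots> = (\<Sum>i\<in>Q. t i * u i * (?X i * (kern i x - kern i y))) + ?X x * t x * u x - ?X y * t y * u y"
      using drop by (simp add: sum_subtractf algebra_simps)
    also have "(\<Sum>i\<in>Q. t i * u i * (?X i * (kern i x - kern i y)))
      = (\<Sum>i\<in>Q. t i * u i * ((?X x - ?X y) * (kern i x * kern i y)))"
      using Q by (intro sum.cong refl arg_cong2[where f = "(*)"] kern_partial_fraction[symmetric]) auto
    \<comment> \<open>\<open>kern_mult\<close> supplies the missing kernel between \<open>x\<close>
      and \<open>y\<close>, so that every term carries the factor X^x - X^y.\<close>
    also have "?X x * t x * u x = (?X x - ?X y) * (t x * u x * kern x y)"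
      using kern_mult[of x y] y by (simp add: algebra_simps)
    also have "?X y * t y * u y = - (?X x - ?X y) * (t y * u y * kern y x)"
      using kern_mult[of y x] y by (simp add: algebra_simps)
    also have "(\<Sum>i\<in>Q. t i * u i * ((?X x - ?X y) * (kern i x * kern i y)))
        + (?X x - ?X y) * (t x * u x * kern x y) - - (?X x - ?X y) * (t y * u y * kern y x)
      = (?X x - ?X y) * (t x * u x * kern x y + t y * u y * kern y x + (\<Sum>i\<in>Q. t i * u i * (kern i x * kern i y)))"
      by (simp add: algebra_simps sum_distrib_left sum_subtractf)
    finally have "excess w (R \<union> S) (int d)
      = t x * u x * kern x y + t y * u y * kern y x + (\<Sum>i\<in>Q. t i * u i * (kern i x * kern i y))"
      using fps_X_power_diff_neq_0[of x y] y by simp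
    also have "t x * u x * kern x y = t x * (\<Prod>j\<in>R - {x}. kern x j)"
    proof -
      have "R - {x} = insert y (Q - {x})" "y \<notin> Q - {x}" using R Q y by auto
      then show ?thesis using Q by (simp add: u_def)
    qed
    also have "t y * u y * kern y x = t y * (\<Prod>j\<in>R - {y}. kern y j)"
    proof -
      have "R - {y} = insert x (Q - {y})" "x \<notin> Q - {y}" using R Q y by auto
      then show ?thesis using Q by (simp add: u_def)
    qed
    also have "(\<Sum>i\<in>Q. t i * u i * (kern i x * kern i y)) = (\<Sum>i\<in>Q. t i * (\<Prod>j\<in>R - {i}. kern i j))"
    proof (rule sum.cong[OF refl])
      fix i assume "i \<in> Q"
      then have "R - {i} = insert x (insert y (Q - {i}))" using R Q by auto
      then show "t i * u i * (kern i x * kern i y) = t i * (\<Prod>j\<in>R - {i}. kern i j)"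
        using Q y by (simp add: u_def mult_ac)
    qed
    also have "t x * (\<Prod>j\<in>R - {x}. kern x j) + t y * (\<Prod>j\<in>R - {y}. kern y j) + (\<Sum>i\<in>Q. t i * (\<Prod>j\<in>R - {i}. kern i j))
      = (\<Sum>i\<in>R. t i * (\<Prod>j\<in>R - {i}. kern i j))"
      using Q y by (simp add: R add.assoc)
    finally show ?thesis by (simp add: t_def mult_ac)
  qed
qed

section \<open>The limit\<close>

text \<open>At least one of the truncated differences is 0, so one formula of the shape sign, shift,
  geometric series covers both cases and can be multiplied over \<open>y\<close>.\<close>

lemma kern_altdef:
  "kern x y = fps_const (if x < y then 1 else -1) * fps_X ^ (x - y) * geo ((y - x) + (x - y))"
  by (simp add: kern_def flip: fps_const_neg)

lemma prod_fps_const: "(\<Prod>i\<in>A. fps_const (c i)) = fps_const (\<Prod>i\<in>A. c i :: real)"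
  by (induction A rule: infinite_finite_induct) auto

lemma lead_term:
  assumes fin: "finite R" "finite S" "finite J" and x: "x \<in> R"
    and pos: "R \<subseteq> {0<..}" "S \<subseteq> {0<..}" "J \<subseteq> {0<..}"
    and gcd: "Gcd (R \<union> S) = 1" and card: "card R + card S + card J = Suc k"
  shows "lead k ((\<Prod>a\<in>J. geo a) * (fps_X ^ x * geo x * (\<Prod>y\<in>R - {x}. kern x y) * (\<Prod>y\<in>S. geo (x + y))))
    (1 / (fact k * (\<Prod>a\<in>J. real a)) *
     (1 / (real x * (\<Prod>y\<in>R - {x}. real y - real x) * (\<Prod>y\<in>S. real y + real x))))"
proof -
  \<comment> \<open>This is |x - y|, written with truncated subtraction.\<close>
  define \<delta> where "\<delta> y = (y - x) + (x - y)" for y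
  define \<epsilon> :: "nat \<Rightarrow> real" where "\<epsilon> y = (if x < y then 1 else -1)" for y
  define M where "M = mset_set J + {#x#} + image_mset \<delta> (mset_set (R - {x})) + image_mset ((+) x) (mset_set S)"
  have set_M: "set_mset M = insert x (J \<union> \<delta> ` (R - {x}) \<union> (+) x ` S)"
    using fin by (auto simp: M_def)
  have "0 \<notin># M" using pos x by (auto simp: set_M \<delta>_def)
  \<comment> \<open>A common divisor of x, all |x - y| and all x + y divides every element of
    \<open>R\<close> and \<open>S\<close>.\<close>
  moreover have "Gcd (set_mset M) = 1"
  proof -
    define g where "g = Gcd (set_mset M)"
    have g: "g dvd a" if "a \<in># M" for a using that by (simp add: g_def)
    have gx: "g dvd x" using g by (simp add: set_M)
    have "g dvd y" if "y \<in> R" for y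
    proof (cases "y = x")
      case False
      then have "g dvd \<delta> y" using that g by (simp add: set_M)
      then show ?thesis using gx
        by (cases "x \<le> y") (auto simp: \<delta>_def dest: dvd_diffD dvd_diffD1)
    qed (use gx in simp)
    moreover have "g dvd y" if "y \<in> S" for y
    proof -
      have "g dvd x + y" using that g by (simp add: set_M)
      then show ?thesis using gx by (simp add: dvd_add_right_iff)
    qed
    ultimately have "g dvd Gcd (R \<union> S)" by (intro Gcd_greatest) auto
    then show ?thesis using gcd by (simp add: g_def)
  qed
  moreover have "size M = Suc k"
  proof -
    have "card R = Suc (card (R - {x}))" using fin(1) x by (rule card.remove)
    then show ?thesis using card by (simp add: M_def)
  qed
  ultimately have "lead k (geos M) (1 / (fact k * real (\<Prod>\<^sub># M)))" by (rule lead_geos)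
  then have "lead k (fps_const (\<Prod>y\<in>R - {x}. \<epsilon> y) * (fps_X ^ (x + (\<Sum>y\<in>R - {x}. x - y)) * geos M))
    ((\<Prod>y\<in>R - {x}. \<epsilon> y) * (1 / (fact k * real (\<Prod>\<^sub># M))))"
    by (intro lead_const_mult) (simp only: lead_shift)
  also have "fps_const (\<Prod>y\<in>R - {x}. \<epsilon> y) * (fps_X ^ (x + (\<Sum>y\<in>R - {x}. x - y)) * geos M)
    = (\<Prod>a\<in>J. geo a) * (fps_X ^ x * geo x * (\<Prod>y\<in>R - {x}. kern x y) * (\<Prod>y\<in>S. geo (x + y)))"
  proof -
    have "(\<Prod>y\<in>R - {x}. kern x y) = fps_const (\<Prod>y\<in>R - {x}. \<epsilon> y) * fps_X ^ (\<Sum>y\<in>R - {x}. x - y)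
      * (\<Prod>y\<in>R - {x}. geo (\<delta> y))"
      by (simp add: kern_altdef \<delta>_def \<epsilon>_def prod.distrib power_sum flip: prod_fps_const)
    moreover have "geos M = (\<Prod>a\<in>J. geo a) * geo x * (\<Prod>y\<in>R - {x}. geo (\<delta> y)) * (\<Prod>y\<in>S. geo (x + y))"
      by (simp add: M_def image_mset.compositionality o_def prod_unfold_prod_mset mult_ac)
    ultimately show ?thesis by (simp only: power_add mult_ac)
  qed
  also have "(\<Prod>y\<in>R - {x}. \<epsilon> y) * (1 / (fact k * real (\<Prod>\<^sub># M)))
    = 1 / (fact k * (\<Prod>a\<in>J. real a)) *
     (1 / (real x * (\<Prod>y\<in>R - {x}. real y - real x) * (\<Prod>y\<in>S. real y + real x)))"
  proof -
    have "\<Prod>\<^sub># M = (\<Prod>a\<in>J. a) * x * (\<Prod>y\<in>R - {x}. \<delta> y) * (\<Prod>y\<in>S. x + y)"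
      by (simp add: M_def image_mset.compositionality o_def prod_unfold_prod_mset mult_ac)
    then have M: "real (\<Prod>\<^sub># M) = (\<Prod>a\<in>J. real a) * real x * (\<Prod>y\<in>R - {x}. real (\<delta> y)) * (\<Prod>y\<in>S. real y + real x)"
      by (simp add: add.commute)
    have "(\<Prod>y\<in>R - {x}. real y - real x) = (\<Prod>y\<in>R - {x}. \<epsilon> y * real (\<delta> y))"
      by (intro prod.cong) (auto simp: \<epsilon>_def \<delta>_def of_nat_diff)
    then have \<delta>: "(\<Prod>y\<in>R - {x}. real y - real x) = (\<Prod>y\<in>R - {x}. \<epsilon> y) * (\<Prod>y\<in>R - {x}. real (\<delta> y))"
      by (simp add: prod.distrib)
    define e where "e = (\<Prod>y\<in>R - {x}. \<epsilon> y)"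
    \<comment> \<open>The total sign is its own inverse and can move into the denominator.\<close>
    have "\<epsilon> y * \<epsilon> y = 1" for y by (simp add: \<epsilon>_def)
    then have "e * e = 1" by (simp add: e_def flip: prod.distrib)
    then have "inverse e = e" by (rule inverse_unique)
    then have "e * (1 / a) = 1 / (e * a)" for a by (simp add: divide_inverse)
    then show ?thesis unfolding M \<delta> e_def[symmetric] by (simp only:) (simp add: mult_ac)
  qed
  finally show ?thesis .
qed

section \<open>Partition counts as coefficients, and their ratio\<close>

lemma p_RSI_eq_nth:
  assumes "finite (R \<union> S \<union> I)" "R \<union> S \<union> I \<subseteq> {0<..}"
  shows "real (p_RSI R S I n) = (\<Prod>a\<in>R \<union> S \<union> I. geo a) $ n"
  unfolding excess_total[OF assms, of "\<lambda>_. 0" "-1", simplified, symmetric]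
  by (simp add: excess_def p_RSI_def)

lemma p_R_gt_S_I_eq_nth:
  assumes "R \<inter> S = {}"
  shows "real (p_R_gt_S_I R S I n)
    = excess (\<lambda>x. if x \<in> R then 1 else if x \<in> S then -1 else 0) (R \<union> S \<union> I) 0 $ n"
proof -
  have "(\<Sum>x\<in>#P. if x \<in> R then 1 else if x \<in> S then -1 else 0)
    = int (size {#x \<in># P. x \<in> R#}) - int (size {#x \<in># P. x \<in> S#})" for P
    using assms by (induction P) auto
  then show ?thesis by (simp add: excess_def p_R_gt_S_I_def)
qed

text \<open>Both counts are compared with n^k for k + 1 = |R| + |S| + |I|, and the constant
  \<open>c\<close>, which holds k! and the product over \<open>I\<close>, cancels in the
  quotient.\<close>

lemma ratio_limit:
  assumes fin: "finite R" "finite S" "finite I"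
    and pos: "R \<subseteq> {0<..}" "S \<subseteq> {0<..}" "I \<subseteq> {0<..}"
    and disj: "R \<inter> S = {}" "I \<inter> (R \<union> S) = {}" and gcd: "Gcd (R \<union> S) = 1"
  shows "(\<lambda>n. real (p_R_gt_S_I R S I n) / real (p_RSI R S I n)) \<longlonglongrightarrow>
    (\<Prod>x\<in>R. real x) * (\<Prod>y\<in>S. real y) *
    (\<Sum>x\<in>R. 1 / (real x * (\<Prod>y\<in>R - {x}. real y - real x) * (\<Prod>y\<in>S. real y + real x)))"
proof -
  \<comment> \<open>The gcd of the empty set is 0. Some part therefore exists, and the number of
    factors is a successor.\<close>
  have "R \<union> S \<noteq> {}" using gcd by (metis Gcd_empty zero_neq_one)
  then have "card (R \<union> S \<union> I) > 0" using fin by (auto simp: card_gt_0_iff)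
  then obtain k where k: "card (R \<union> S \<union> I) = Suc k" using gr0_implies_Suc by blast
  have disj': "(R \<union> S) \<inter> I = {}" using disj by blast
  have card: "card R + card S + card I = Suc k"
    using k fin disj(1) disj' by (simp add: card_Un_disjoint)
  define w where "w x = (if x \<in> R then 1 else if x \<in> S then -1 else 0 :: int)" for x
  have w: "\<And>x. x \<in> R \<Longrightarrow> w x = 1" "\<And>y. y \<in> S \<Longrightarrow> w y = -1"
    using disj by (auto simp: w_def)
  define q where "q x = 1 / (real x * (\<Prod>y\<in>R - {x}. real y - real x) * (\<Prod>y\<in>S. real y + real x))" for x
  define c where "c = 1 / (fact k * (\<Prod>a\<in>I. real a))"

  have "lead k (excess w (R \<union> S \<union> I) 0) (\<Sum>x\<in>R. c * q x)"
  proof (cases "R = {}")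
    case True
    then have "excess w (R \<union> S \<union> I) 0 = 0" by (intro excess_eq_0) (auto simp: w_def)
    then show ?thesis using True by (simp add: lead_zero)
  next
    case False
    have "excess w (R \<union> S \<union> I) 0 = (\<Prod>a\<in>I. geo a) * excess w (R \<union> S) 0"
      using fin pos disj by (intro excess_neutral) (auto simp: w_def)
    also have "excess w (R \<union> S) 0 = (\<Sum>x\<in>R. fps_X ^ x * geo x
      * (\<Prod>y\<in>R - {x}. kern x y) * (\<Prod>y\<in>S. geo (x + y)))"
      using excess_sum[OF fin(1) False fin(2) disj(1) pos(1,2), of w 0] w by simp
    finally have "excess w (R \<union> S \<union> I) 0 = (\<Sum>x\<in>R. (\<Prod>a\<in>I. geo a) * (fps_X ^ x * geo x
      * (\<Prod>y\<in>R - {x}. kern x y) * (\<Prod>y\<in>S. geo (x + y))))"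
      by (simp add: sum_distrib_left)
    then show ?thesis
      unfolding c_def q_def by (auto simp only: intro!: lead_sum lead_term[OF fin _ pos gcd card])
  qed
  then have num: "(\<lambda>n. real (p_R_gt_S_I R S I n) / real n ^ k) \<longlonglongrightarrow> c * (\<Sum>x\<in>R. q x)"
    unfolding lead_def p_R_gt_S_I_eq_nth[OF disj(1)] w_def by (simp add: sum_distrib_left)

  define A where "A = R \<union> S \<union> I"
  have A: "finite A" "A \<subseteq> {0<..}" using fin pos by (auto simp: A_def)
  have "Gcd A dvd Gcd (R \<union> S)" by (intro Gcd_greatest) (auto simp: A_def)
  then have "Gcd A = 1" using gcd by simp
  with A k have "lead k (geos (mset_set A)) (1 / (fact k * real (\<Prod>\<^sub># (mset_set A))))"
    by (intro lead_geos) (auto simp: A_def)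
  moreover have "real (\<Prod>\<^sub># (mset_set A)) = (\<Prod>a\<in>A. real a)"
    unfolding of_nat_prod[symmetric] by (simp add: prod_unfold_prod_mset)
  ultimately have "lead k (\<Prod>a\<in>A. geo a) (1 / (fact k * (\<Prod>a\<in>A. real a)))"
    by (simp add: prod_unfold_prod_mset)
  moreover have "(\<Prod>a\<in>A. real a) = (\<Prod>x\<in>R. real x) * (\<Prod>y\<in>S. real y) * (\<Prod>a\<in>I. real a)"
    using fin disj(1) disj' by (simp add: A_def prod.union_disjoint)
  ultimately have den: "(\<lambda>n. real (p_RSI R S I n) / real n ^ k)
      \<longlonglongrightarrow> c / ((\<Prod>x\<in>R. real x) * (\<Prod>y\<in>S. real y))"
    using p_RSI_eq_nth[of R S I] A by (simp add: lead_def c_def A_def mult_ac)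
  have nz: "c \<noteq> 0" "(\<Prod>x\<in>R. real x) \<noteq> 0" "(\<Prod>y\<in>S. real y) \<noteq> 0"
    using fin pos by (auto simp: c_def)
  then have "(\<lambda>n. (real (p_R_gt_S_I R S I n) / real n ^ k) / (real (p_RSI R S I n) / real n ^ k))
      \<longlonglongrightarrow> c * (\<Sum>x\<in>R. q x) / (c / ((\<Prod>x\<in>R. real x) * (\<Prod>y\<in>S. real y)))"
    by (intro tendsto_divide[OF num den]) simp
  also have "c * (\<Sum>x\<in>R. q x) / (c / ((\<Prod>x\<in>R. real x) * (\<Prod>y\<in>S. real y)))
    = (\<Prod>x\<in>R. real x) * (\<Prod>y\<in>S. real y) * (\<Sum>x\<in>R. q x)"
    using nz by simp
  \<comment> \<open>For n > 0 the powers n^k cancel.\<close>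
  finally show ?thesis
    unfolding q_def
    by (rule Lim_transform_eventually) (rule eventually_mono[OF eventually_gt_at_top[of 0]], simp)
qed

section \<open>Passage from sets to enumerated parts\<close>

theorem theorem1:
  fixes r s :: "nat \<Rightarrow> nat" and l m :: nat and R S I :: "nat set"
  assumes R_eq: "R = r ` {1..l}" and r_distinct: "inj_on r {1..l}"
    and S_eq: "S = s ` {1..m}" and s_distinct: "inj_on s {1..m}"
    and R_pos: "R \<subseteq> {0<..}" and S_pos: "S \<subseteq> {0<..}"
    and R_S_disjoint: "R \<inter> S = {}"
    and I_finite: "finite I" and I_subset: "I \<subseteq> {0<..} - (R \<union> S)"
    and gcd_1: "Gcd (R \<union> S) = 1"
  shows "(\<lambda>n. real (p_R_gt_S_I R S I n) / real (p_RSI R S I n)) \<longlonglongrightarrow>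
    (\<Prod>j=1..l. real (r j)) * (\<Prod>i=1..m. real (s i)) *
    (\<Sum>i=1..l. (-1) ^ (i - 1) /
       (real (r i) * (\<Prod>j=i+1..l. real (r j) - real (r i))
        * (\<Prod>t=1..i-1. real (r i) - real (r t))
        * (\<Prod>k=1..m. real (s k) + real (r i))))"
proof -
  have prod_S: "(\<Prod>y\<in>S. f y) = (\<Prod>k=1..m. f (s k))" for f :: "nat \<Rightarrow> real"
    unfolding S_eq using s_distinct by (simp add: prod.reindex)
  have sum_R: "(\<Sum>x\<in>R. f x) = (\<Sum>i=1..l. f (r i))" for f :: "nat \<Rightarrow> real"
    unfolding R_eq using r_distinct by (simp add: sum.reindex)
  \<comment> \<open>The i - 1 factors with index t < i are reversed, each contributing one
    sign.\<close>
  have prod_R: "(\<Prod>y\<in>R - {r i}. real y - real (r i))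
    = (\<Prod>j=i+1..l. real (r j) - real (r i)) * ((-1) ^ (i - 1) * (\<Prod>t=1..i-1. real (r i) - real (r t)))"
    if i: "i \<in> {1..l}" for i
  proof -
    have "R - {r i} = r ` ({1..l} - {i})"
      unfolding R_eq using i inj_on_image_set_diff[OF r_distinct, of "{1..l}" "{i}"] by simp
    moreover have "inj_on r ({1..l} - {i})" using r_distinct by (rule inj_on_subset) auto
    ultimately have "(\<Prod>y\<in>R - {r i}. real y - real (r i)) = (\<Prod>j\<in>{1..l} - {i}. real (r j) - real (r i))"
      by (simp add: prod.reindex)
    also have "{1..l} - {i} = {i+1..l} \<union> {1..i-1}" using i by auto
    also have "(\<Prod>j\<in>{i+1..l} \<union> {1..i-1}. real (r j) - real (r i))
      = (\<Prod>j=i+1..l. real (r j) - real (r i)) * (\<Prod>t=1..i-1. real (r t) - real (r i))"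
      by (rule prod.union_disjoint) auto
    also have "(\<Prod>t=1..i-1. real (r t) - real (r i)) = (\<Prod>t=1..i-1. (-1) * (real (r i) - real (r t)))"
      by simp
    also have "\<dots> = (-1) ^ (i - 1) * (\<Prod>t=1..i-1. real (r i) - real (r t))"
      by (subst prod.distrib) simp
    finally show ?thesis .
  qed
  have "(\<Sum>x\<in>R. 1 / (real x * (\<Prod>y\<in>R - {x}. real y - real x) * (\<Prod>y\<in>S. real y + real x)))
    = (\<Sum>i=1..l. 1 / (real (r i) * ((\<Prod>j=i+1..l. real (r j) - real (r i))
        * ((-1) ^ (i - 1) * (\<Prod>t=1..i-1. real (r i) - real (r t))))
        * (\<Prod>k=1..m. real (s k) + real (r i))))"
    unfolding sum_R prod_S by (intro sum.cong refl) (simp only: prod_R)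
  also have "\<dots> = (\<Sum>i=1..l. (-1) ^ (i - 1) /
       (real (r i) * (\<Prod>j=i+1..l. real (r j) - real (r i))
        * (\<Prod>t=1..i-1. real (r i) - real (r t))
        * (\<Prod>k=1..m. real (s k) + real (r i))))"
  proof (rule sum.cong[OF refl])
    have "1 / (a * (b * ((-1) ^ n * c)) * d) = (-1) ^ n / (a * b * c * d)" for a b c d :: real and n
      by (cases "even n") simp_all
    then show "1 / (real (r i) * ((\<Prod>j=i+1..l. real (r j) - real (r i))
        * ((-1) ^ (i - 1) * (\<Prod>t=1..i-1. real (r i) - real (r t))))
        * (\<Prod>k=1..m. real (s k) + real (r i))) = (-1) ^ (i - 1) /
       (real (r i) * (\<Prod>j=i+1..l. real (r j) - real (r i))
        * (\<Prod>t=1..i-1. real (r i) - real (r t))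
        * (\<Prod>k=1..m. real (s k) + real (r i)))" for i .
  qed
  finally have sum_eq: "(\<Sum>x\<in>R. 1 / (real x * (\<Prod>y\<in>R - {x}. real y - real x) * (\<Prod>y\<in>S. real y + real x)))
    = (\<Sum>i=1..l. (-1) ^ (i - 1) /
       (real (r i) * (\<Prod>j=i+1..l. real (r j) - real (r i))
        * (\<Prod>t=1..i-1. real (r i) - real (r t))
        * (\<Prod>k=1..m. real (s k) + real (r i))))" .
  have prod_R': "(\<Prod>x\<in>R. real x) = (\<Prod>j=1..l. real (r j))"
    unfolding R_eq using r_distinct by (simp add: prod.reindex)
  have "finite R" "finite S" "I \<subseteq> {0<..}" "I \<inter> (R \<union> S) = {}"
    using R_eq S_eq I_subset by auto
  then show ?thesis
    using ratio_limit[of R S I] I_finite R_pos S_pos R_S_disjoint gcd_1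
    by (simp only: sum_eq prod_R' prod_S[of real])
qed

end
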